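(* (1) Let $A$ be a set of at most four alternatives (parties), let $n$ be an odd positive integer, and let $P$ be an $(A,n)$-profile that is single-peaked and in which no alternative is ranked first by a majority (more than $n/2$) of the voters. Then the LUR procedure selects exactly the top choice $m$ of the median voter, i.e. $\mathrm{LUR}(P)=\{m\}$. (2) This property does not hold in general for first-past-the-post: there exist a set $A$ of at most four alternatives, an odd $n$, and a single-peaked $(A,n)$-profile $P$ in which no alternative is ranked first by a majority of the voters, such that the top choice of the median voter is not a first-past-the-post winner at $P$.
   Context: A ballot is a linear ordering of the finite set $A$ (a strict ranking without ties). For $N=\{1,\dots,n\}$, an $(A,n)$-profile $P$ is an $n$-tuple of ballots, one per voter. Single-peakedness: $P$ is single-peaked if there is a linear order $<$ on $A$ (an axis) such that for all $x,y,z\in A$ with $x<y<z$ or $z<y<x$ and every voter $i$, if $i$ prefers $x$ to $y$ then $i$ prefers $y$ to $z$. Median voter: with respect to such an axis $<$, sort the voters by the position on the axis of their most preferred alternative (breaking ties arbitrarily); for $n$ odd, the $((n+1)/2)$-th voter is the median voter. The top choice of the median voter (the "median party") is always identical to the Condorcet winner. LUR (Least Unpopular Reselection): for a nonempty $S\subseteq A$, let $P|_S$ be the profile obtained by restricting each ballot to $S$, and let $V_{LU}(P|_S)$ be the set of alternatives of $S$ that are ranked last (among $S$) by the fewest voters. Put $W_0=A$ and $W_{k+1}=V_{LU}(P|_{W_k})$. This decreasing sequence of nonempty sets becomes constant, and $\mathrm{LUR}(P)$ is its eventual value, $W_{|A|}$. First-past-the-post: the winners are the alternatives ranked first by the largest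 number of voters. *)

theory Defs
  imports Main
begin

text \<open>
  A ballot over \<open>A\<close> is a reflexive linear order \<open>r\<close> on \<open>A\<close>, where \<open>(x, y) \<in> r\<close> means that \<open>x\<close> is
  ranked at least as high as \<open>y\<close>; by antisymmetry there are no ties. In an axis, likewise a
  reflexive linear order, \<open>(x, y)\<close> means that \<open>x\<close> equals \<open>y\<close> or lies to the left of \<open>y\<close>.
  The strict part of a ballot or axis is \<open>precedes\<close>.
\<close>

type_synonym 'a profile = "nat \<Rightarrow> 'a rel"

abbreviation voters :: "nat \<Rightarrow> nat set" where
  "voters n \<equiv> {1..n}"

definition is_profile :: "'a set \<Rightarrow> nat \<Rightarrow> 'a profile \<Rightarrow> bool" where
  "is_profile A n P \<longleftrightarrow> (\<forall>i\<in>voters n. linear_order_on A (P i))"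

definition precedes :: "'a rel \<Rightarrow> 'a \<Rightarrow> 'a \<Rightarrow> bool" where
  "precedes r x y \<longleftrightarrow> (x, y) \<in> r \<and> x \<noteq> y"

definition single_peaked_wrt :: "'a set \<Rightarrow> nat \<Rightarrow> 'a rel \<Rightarrow> 'a profile \<Rightarrow> bool" where
  "single_peaked_wrt A n ax P \<longleftrightarrow> linear_order_on A ax \<and>
     (\<forall>x\<in>A. \<forall>y\<in>A. \<forall>z\<in>A.
        precedes ax x y \<and> precedes ax y z \<or> precedes ax z y \<and> precedes ax y x \<longrightarrow>
        (\<forall>i\<in>voters n. precedes (P i) x y \<longrightarrow> precedes (P i) y z))"

definition single_peaked :: "'a set \<Rightarrow> nat \<Rightarrow> 'a profile \<Rightarrow> bool" where
  "single_peaked A n P \<longleftrightarrow> (\<exists>ax. single_peaked_wrt A n ax P)"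

definition ranked_first :: "'a set \<Rightarrow> 'a rel \<Rightarrow> 'a \<Rightarrow> bool" where
  "ranked_first A r x \<longleftrightarrow> x \<in> A \<and> (\<forall>y\<in>A. (x, y) \<in> r)"

definition ranked_last :: "'a set \<Rightarrow> 'a rel \<Rightarrow> 'a \<Rightarrow> bool" where
  "ranked_last A r x \<longleftrightarrow> x \<in> A \<and> (\<forall>y\<in>A. (y, x) \<in> r)"

definition top_choice :: "'a set \<Rightarrow> 'a rel \<Rightarrow> 'a" where
  "top_choice A r = (THE x. ranked_first A r x)"

definition first_count :: "'a set \<Rightarrow> nat \<Rightarrow> 'a profile \<Rightarrow> 'a \<Rightarrow> nat" where
  "first_count A n P x = card {i \<in> voters n. ranked_first A (P i) x}"

definition last_count :: "'a set \<Rightarrow> nat \<Rightarrow> 'a profile \<Rightarrow> 'a \<Rightarrow> nat" where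
  "last_count A n P x = card {i \<in> voters n. ranked_last A (P i) x}"

definition has_majority_winner :: "'a set \<Rightarrow> nat \<Rightarrow> 'a profile \<Rightarrow> bool" where
  "has_majority_winner A n P \<longleftrightarrow> (\<exists>x\<in>A. 2 * first_count A n P x > n)"

text \<open>
  \<open>\<sigma> k\<close> is the voter in position \<open>k\<close> of the sorted list. The sorting is any admissible one, so
  several voters may be median voters, according to how ties are broken.
\<close>

definition sorts_voters :: "'a set \<Rightarrow> nat \<Rightarrow> 'a rel \<Rightarrow> 'a profile \<Rightarrow> (nat \<Rightarrow> nat) \<Rightarrow> bool" where
  "sorts_voters A n ax P \<sigma> \<longleftrightarrow> bij_betw \<sigma> {1..n} (voters n) \<and>
     (\<forall>j\<in>{1..n}. \<forall>k\<in>{1..n}. j \<le> k \<longrightarrow>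
        (top_choice A (P (\<sigma> j)), top_choice A (P (\<sigma> k))) \<in> ax)"

definition is_median_voter :: "'a set \<Rightarrow> nat \<Rightarrow> 'a rel \<Rightarrow> 'a profile \<Rightarrow> nat \<Rightarrow> bool" where
  "is_median_voter A n ax P v \<longleftrightarrow> (\<exists>\<sigma>. sorts_voters A n ax P \<sigma> \<and> v = \<sigma> ((n + 1) div 2))"

definition restrict_profile :: "'a profile \<Rightarrow> 'a set \<Rightarrow> 'a profile" where
  "restrict_profile P S = (\<lambda>i. P i \<inter> S \<times> S)"

definition least_unpopular :: "'a set \<Rightarrow> nat \<Rightarrow> 'a profile \<Rightarrow> 'a set" where
  "least_unpopular A n P = {x \<in> A. \<forall>y\<in>A. last_count A n P x \<le> last_count A n P y}"

primrec LUR_stage :: "'a set \<Rightarrow> nat \<Rightarrow> 'a profile \<Rightarrow> nat \<Rightarrow> 'a set" where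
  "LUR_stage A n P 0 = A"
| "LUR_stage A n P (Suc k) =
     least_unpopular (LUR_stage A n P k) n (restrict_profile P (LUR_stage A n P k))"

definition LUR :: "'a set \<Rightarrow> nat \<Rightarrow> 'a profile \<Rightarrow> 'a set" where
  "LUR A n P = LUR_stage A n P (card A)"

definition FPTP :: "'a set \<Rightarrow> nat \<Rightarrow> 'a profile \<Rightarrow> 'a set" where
  "FPTP A n P = {x \<in> A. \<forall>y\<in>A. first_count A n P y \<le> first_count A n P x}"

lemma ranked_first_unique:
  assumes "linear_order_on A r" "ranked_first A r x" "ranked_first A r y"
  shows "x = y"
proof -
  have "antisym r" using assms(1) by (simp add: order_on_defs)
  then show ?thesis using assms(2,3) by (auto simp: ranked_first_def dest: antisymD)
qed

lemma ranked_first_exists: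
  assumes "finite A" "A \<noteq> {}" "linear_order_on A r"
  shows "\<exists>x. ranked_first A r x"
proof -
  have "S \<subseteq> A \<longrightarrow> (\<exists>x\<in>S. \<forall>y\<in>S. (x, y) \<in> r)" if "finite S" "S \<noteq> {}" for S
    using that
  proof (induction S rule: finite_ne_induct)
    case (singleton x)
    then show ?case using assms(3) by (auto simp: order_on_defs refl_on_def)
  next
    case (insert a S)
    show ?case
    proof
      assume sub: "insert a S \<subseteq> A"
      then obtain x where x: "x \<in> S" "\<forall>y\<in>S. (x, y) \<in> r" using insert by auto
      have refl: "(a, a) \<in> r" "(x, x) \<in> r"
        using assms(3) sub x by (auto simp: order_on_defs refl_on_def)
      have total: "total_on A r" and trans: "trans r"
        using assms(3) by (simp_all add: order_on_defs)
      have "a \<noteq> x" using x(1) insert.hyps by blast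
      then consider "(a, x) \<in> r" | "(x, a) \<in> r" using total sub x(1) unfolding total_on_def by blast
      then show "\<exists>x\<in>insert a S. \<forall>y\<in>insert a S. (x, y) \<in> r"
      proof cases
        case 1
        then have "\<forall>y\<in>insert a S. (a, y) \<in> r" using x(2) refl transD[OF trans] by blast
        then show ?thesis by blast
      next
        case 2
        then have "\<forall>y\<in>insert a S. (x, y) \<in> r" using x(2) by blast
        then show ?thesis using x(1) by blast
      qed
    qed
  qed
  from this[OF assms(1,2)] show ?thesis by (auto simp: ranked_first_def)
qed

lemma ranked_first_top_choice:
  assumes "finite A" "A \<noteq> {}" "linear_order_on A r"
  shows "ranked_first A r (top_choice A r)"
  unfolding top_choice_def
proof (rule theI')
  show "\<exists>!x. ranked_first A r x"
    using ranked_first_exists[OF assms] ranked_first_unique[OF assms(3)] by blast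
qed

lemma median_voter_exists:
  assumes fin: "finite A" and ne: "A \<noteq> {}" and prof: "is_profile A n P"
    and ax: "linear_order_on A ax"
  shows "\<exists>v. is_median_voter A n ax P v"
proof -
  define pos where "pos x = card {y \<in> A. (y, x) \<in> ax}" for x
  have pos: "(x, y) \<in> ax" if "x \<in> A" "y \<in> A" "pos x \<le> pos y" for x y
  proof (rule ccontr)
    assume nxy: "(x, y) \<notin> ax"
    have refl: "(x, x) \<in> ax" using ax that by (auto simp: order_on_defs refl_on_def)
    have total: "total_on A ax" and trans: "trans ax" using ax by (simp_all add: order_on_defs)
    have "x \<noteq> y" using nxy refl by blast
    then have yx: "(y, x) \<in> ax" using total nxy that unfolding total_on_def by blast
    have "{z \<in> A. (z, y) \<in> ax} \<subseteq> {z \<in> A. (z, x) \<in> ax}"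
      using transD[OF trans _ yx] by blast
    then have "{z \<in> A. (z, y) \<in> ax} \<subset> {z \<in> A. (z, x) \<in> ax}"
      using nxy refl that by blast
    then have "pos y < pos x" unfolding pos_def using fin by (intro psubset_card_mono) auto
    then show False using that by simp
  qed
  have top: "top_choice A (P i) \<in> A" if "i \<in> voters n" for i
    using ranked_first_top_choice[OF fin ne] prof that
    by (auto simp: is_profile_def ranked_first_def)
  define key where "key i = pos (top_choice A (P i))" for i
  define xs where "xs = sort_key key [1..<Suc n]"
  have len: "length xs = n" and set: "set xs = voters n" and dist: "distinct xs"
    and sorted: "sorted (map key xs)"
    by (auto simp: xs_def)
  define \<sigma> where "\<sigma> k = xs ! (k - 1)" for k
  have "bij_betw (\<lambda>k. k - 1) {1..n} {..<n}"
    by (rule bij_betw_byWitness[where f' = Suc]) auto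
  moreover have "bij_betw ((!) xs) {..<n} (voters n)"
    using bij_betw_nth[OF dist] len set by simp
  ultimately have bij: "bij_betw \<sigma> {1..n} (voters n)"
    unfolding \<sigma>_def by (rule bij_betw_trans[unfolded comp_def])
  have "(top_choice A (P (\<sigma> j)), top_choice A (P (\<sigma> k))) \<in> ax"
    if "j \<in> {1..n}" "k \<in> {1..n}" "j \<le> k" for j k
  proof (rule pos)
    show "top_choice A (P (\<sigma> j)) \<in> A" "top_choice A (P (\<sigma> k)) \<in> A"
      using top bij that by (auto dest: bij_betwE)
    have "j - 1 \<le> k - 1" "k - 1 < length xs" "j - 1 < length xs" using that len by auto
    then have "key (\<sigma> j) \<le> key (\<sigma> k)"
      using sorted_nth_mono[OF sorted] unfolding \<sigma>_def by fastforce
    then show "pos (top_choice A (P (\<sigma> j))) \<le> pos (top_choice A (P (\<sigma> k)))"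
      by (simp add: key_def)
  qed
  with bij show ?thesis unfolding is_median_voter_def sorts_voters_def by blast
qed

end

theory Submission
  imports Defs
begin

text \<open>
  With no majority winner the median top \<open>m\<close> is interior on the axis: if it were an end point, the
  majority preferring it to its neighbour would rank it first. Interior alternatives are never
  ranked last, so one round removes exactly the end points that somebody ranks last. If both
  go, at most two alternatives remain and \<open>m\<close>, the Condorcet winner, is selected next. If
  only one goes, every voter ranked it last, so the first choices are unchanged, there
  is still no majority winner, and the argument repeats on the smaller set.
\<close>

section \<open>Linear orders, first and last places in a subset\<close>

lemma linear_order_on_antisymD:
  assumes "linear_order_on A r" "(x, y) \<in> r" "(y, x) \<in> r"
  shows "x = y"
  using assms by (auto simp: order_on_defs dest: antisymD)

lemma linear_order_on_cases:
  assumes "linear_order_on A r" "x \<in> A" "y \<in> A"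
  shows "(x, y) \<in> r \<or> precedes r y x"
  using assms
  by (cases "x = y") (auto simp: order_on_defs refl_on_def total_on_def precedes_def)

lemma linear_order_on_not_precedes:
  assumes "linear_order_on A r" "x \<in> A" "y \<in> A"
  shows "\<not> precedes r y x \<longleftrightarrow> (x, y) \<in> r"
  using linear_order_on_cases[OF assms] linear_order_on_antisymD[OF assms(1)]
  by (auto simp: precedes_def)

lemma linear_order_on_subset:
  assumes "linear_order_on A r" "S \<subseteq> A"
  shows "linear_order_on S (r \<inter> S \<times> S)"
  using assms
  unfolding order_on_defs refl_on_def total_on_def trans_def antisym_def
  by blast

lemma ranked_first_restrict [simp]: "ranked_first S (r \<inter> S \<times> S) x \<longleftrightarrow> ranked_first S r x"
  by (auto simp: ranked_first_def)

lemma ranked_last_restrict [simp]: "ranked_last S (r \<inter> S \<times> S) x \<longleftrightarrow> ranked_last S r x"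
  by (auto simp: ranked_last_def)

lemma ranked_first_converse [simp]: "ranked_first S (r\<inverse>) x \<longleftrightarrow> ranked_last S r x"
  by (auto simp: ranked_first_def ranked_last_def)

lemma ranked_first_exists_subset:
  assumes "finite S" "S \<noteq> {}" "S \<subseteq> A" "linear_order_on A r"
  shows "\<exists>x. ranked_first S r x"
  using ranked_first_exists[OF assms(1,2) linear_order_on_subset[OF assms(4,3)]] by simp

lemma ranked_last_exists_subset:
  assumes "finite S" "S \<noteq> {}" "S \<subseteq> A" "linear_order_on A r"
  shows "\<exists>x. ranked_last S r x"
  using ranked_first_exists_subset[OF assms(1-3), of "r\<inverse>"] assms(4) by simp

lemma ranked_last_unique:
  assumes "linear_order_on A r" "ranked_last S r x" "ranked_last S r y"
  shows "x = y"
  using assms by (auto simp: ranked_last_def intro: linear_order_on_antisymD)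

section \<open>Rounds of the elimination procedure\<close>

text \<open>\<open>ranked_last S\<close> only compares members of \<open>S\<close>, so every round
  can be computed from the original ballots.\<close>

lemma least_unpopular_restrict_profile [simp]:
  "least_unpopular S n (restrict_profile P S) = least_unpopular S n P"
  by (simp add: least_unpopular_def last_count_def restrict_profile_def)

text \<open>The recursion of \<open>LUR_stage\<close> splits off the last round; an induction over a
  shrinking starting set needs the first round split off instead.\<close>

lemma LUR_stage_Suc_first:
  "LUR_stage S n P (Suc k) = LUR_stage (least_unpopular S n P) n P k"
  by (induction k) simp_all

section \<open>Single-peakedness and the median top as Condorcet winner\<close>

lemma single_peaked_wrt_converse:
  assumes "single_peaked_wrt A n ax P"
  shows "single_peaked_wrt A n (ax\<inverse>) P"
proof -
  have "precedes (ax\<inverse>) x y \<longleftrightarrow> precedes ax y x" for x y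
    by (auto simp: precedes_def)
  then show ?thesis
    using assms unfolding single_peaked_wrt_def by (simp add: disj_commute)
qed

lemma single_peaked_wrtD:
  assumes "single_peaked_wrt A n ax P" "precedes ax x y" "precedes ax y z"
    "x \<in> A" "y \<in> A" "z \<in> A" "i \<in> voters n"
  shows "precedes (P i) x y \<Longrightarrow> precedes (P i) y z"
    and "precedes (P i) z y \<Longrightarrow> precedes (P i) y x"
  using assms unfolding single_peaked_wrt_def by blast+

text \<open>This is the Condorcet property relative to \<open>S\<close>. It is stated with the
  unrestricted ballots, so it passes to subsets at once.\<close>

definition beats_all :: "'a set \<Rightarrow> nat \<Rightarrow> 'a profile \<Rightarrow> 'a \<Rightarrow> bool" where
  "beats_all S n P m \<longleftrightarrow>
     (\<forall>x\<in>S. x \<noteq> m \<longrightarrow> n < 2 * card {i \<in> voters n. precedes (P i) m x})"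

lemma beats_all_mono: "beats_all S n P m \<Longrightarrow> T \<subseteq> S \<Longrightarrow> beats_all T n P m"
  by (auto simp: beats_all_def)

text \<open>Against a rival on one side, the median voter and all voters sorted on the other side
  prefer the median top, and together they are a majority.\<close>

lemma median_beats_all:
  assumes fin: "finite A" and ne: "A \<noteq> {}" and prof: "is_profile A n P" and n: "odd n"
    and sp: "single_peaked_wrt A n ax P" and med: "is_median_voter A n ax P v"
  shows "top_choice A (P v) \<in> A \<and> beats_all A n P (top_choice A (P v))"
proof -
  let ?m = "top_choice A (P v)"
  define h where "h = (n + 1) div 2"
  \<comment> \<open>Since \<open>n\<close> is odd, \<open>h\<close> voters are already a strict
    majority, and the blocks \<open>{1..h}\<close> and \<open>{h..n}\<close> both have size
    \<open>h\<close>.\<close>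
  have h: "2 * h = n + 1" "h \<in> {1..n}" using n by (auto simp: h_def elim!: oddE)
  obtain \<sigma> where v: "v = \<sigma> h" and bij: "bij_betw \<sigma> {1..n} (voters n)"
    and sorted: "\<And>j k. \<lbrakk>j \<in> {1..n}; k \<in> {1..n}; j \<le> k\<rbrakk> \<Longrightarrow>
      (top_choice A (P (\<sigma> j)), top_choice A (P (\<sigma> k))) \<in> ax"
    using med unfolding is_median_voter_def sorts_voters_def h_def by blast
  have \<sigma>: "\<sigma> j \<in> voters n" if "j \<in> {1..n}" for j
    using bij_betwE[OF bij] that by blast
  have lin: "linear_order_on A (P i)" if "i \<in> voters n" for i
    using prof that by (simp add: is_profile_def)
  have ax: "linear_order_on A ax" using sp by (simp add: single_peaked_wrt_def)
  have top: "ranked_first A (P i) (top_choice A (P i))" if "i \<in> voters n" for i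
    using ranked_first_top_choice[OF fin ne lin[OF that]] .
  have top_in: "top_choice A (P i) \<in> A" if "i \<in> voters n" for i
    using top[OF that] by (simp add: ranked_first_def)
  have m: "?m \<in> A" using top_in[OF \<sigma>[OF h(2)]] by (simp add: v)
  \<comment> \<open>The assumption \<open>side\<close> puts the median top weakly between the
    voter's own top and \<open>x\<close>, so the ballot falls from its top through the median top to
    \<open>x\<close>.\<close>
  have pref: "precedes (P i) ?m x"
    if i: "i \<in> voters n" and x: "x \<in> A" "x \<noteq> ?m"
      and side: "(top_choice A (P i), ?m) \<in> ax \<and> (?m, x) \<in> ax \<or>
                 (x, ?m) \<in> ax \<and> (?m, top_choice A (P i)) \<in> ax" for i x
  proof (cases "top_choice A (P i) = ?m")
    case True
    then show ?thesis using top[OF i] x by (auto simp: ranked_first_def precedes_def)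
  next
    case False
    then have pref_top: "precedes (P i) (top_choice A (P i)) ?m"
      using top[OF i] m by (auto simp: ranked_first_def precedes_def)
    from side consider "precedes ax (top_choice A (P i)) ?m" "precedes ax ?m x"
      | "precedes ax x ?m" "precedes ax ?m (top_choice A (P i))"
      using False x by (auto simp: precedes_def)
    then show ?thesis
    proof cases
      case 1
      then show ?thesis using single_peaked_wrtD(1)[OF sp 1 top_in[OF i] m x(1) i] pref_top by blast
    next
      case 2
      then show ?thesis using single_peaked_wrtD(2)[OF sp 2 x(1) m top_in[OF i] i] pref_top by blast
    qed
  qed
  have majority: "n < 2 * card {i \<in> voters n. precedes (P i) ?m x}"
    if J: "J \<subseteq> {1..n}" "card J = h" "\<And>j. j \<in> J \<Longrightarrow> precedes (P (\<sigma> j)) ?m x" for J x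
  proof -
    have "card (\<sigma> ` J) = h"
      using bij J by (metis bij_betw_imp_inj_on card_image inj_on_subset)
    moreover have "\<sigma> ` J \<subseteq> {i \<in> voters n. precedes (P i) ?m x}"
      using \<sigma> J by blast
    ultimately have "h \<le> card {i \<in> voters n. precedes (P i) ?m x}"
      using card_mono[of "{i \<in> voters n. precedes (P i) ?m x}" "\<sigma> ` J"] by simp
    then show ?thesis using h by simp
  qed
  have "n < 2 * card {i \<in> voters n. precedes (P i) ?m x}" if x: "x \<in> A" "x \<noteq> ?m" for x
  proof -
    \<comment> \<open>If \<open>x\<close> is to the right, positions \<open>1..h\<close> have their
      tops at or left of the median top; if \<open>x\<close> is to the left, positions
      \<open>h..n\<close> have theirs at or right of it.\<close>
    consider "(?m, x) \<in> ax" | "(x, ?m) \<in> ax"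
      using linear_order_on_cases[OF ax m x(1)] by (auto simp: precedes_def)
    then show ?thesis
    proof cases
      case 1
      show ?thesis
      proof (rule majority[of "{1..h}"])
        show "precedes (P (\<sigma> j)) ?m x" if "j \<in> {1..h}" for j
          by (rule pref[OF \<sigma> x]) (use 1 h that sorted[of j h] in \<open>auto simp: v\<close>)
      qed (use h in auto)
    next
      case 2
      show ?thesis
      proof (rule majority[of "{h..n}"])
        show "precedes (P (\<sigma> j)) ?m x" if "j \<in> {h..n}" for j
          by (rule pref[OF \<sigma> x]) (use 2 h that sorted[of h j] in \<open>auto simp: v\<close>)
      qed (use h in auto)
    qed
  qed
  with m show ?thesis by (simp add: beats_all_def)
qed

section \<open>End points and interior points of the axis\<close>

text \<open>Let \<open>b\<close> be the neighbour of the left end \<open>m\<close> within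
  \<open>S\<close>. A voter who prefers \<open>m\<close> to \<open>b\<close> descends further beyond
  \<open>b\<close>, hence ranks \<open>m\<close> first in \<open>S\<close>; the voters who do so are
  a majority by \<open>beats\<close>.\<close>

lemma axis_end_majority:
  assumes fin: "finite A" and prof: "is_profile A n P" and n: "n > 0"
    and sp: "single_peaked_wrt A n ax P" and S: "S \<subseteq> A"
    and m: "ranked_first S ax m" and beats: "beats_all S n P m"
  shows "has_majority_winner S n P"
proof -
  have mS: "m \<in> S" using m by (simp add: ranked_first_def)
  have lin: "linear_order_on A (P i)" if "i \<in> voters n" for i
    using prof that by (simp add: is_profile_def)
  have ax: "linear_order_on A ax" using sp by (simp add: single_peaked_wrt_def)
  have refl: "(m, m) \<in> P i" if "i \<in> voters n" for i
    using linear_order_on_cases[OF lin[OF that], of m m] mS S by (auto simp: precedes_def)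
  have "n < 2 * first_count S n P m"
  proof (cases "S = {m}")
    case True
    then have "{i \<in> voters n. ranked_first S (P i) m} = voters n"
      using refl by (auto simp: ranked_first_def)
    then show ?thesis using n by (simp add: first_count_def)
  next
    case False
    have "finite (S - {m})" "S - {m} \<noteq> {}" "S - {m} \<subseteq> A"
      using fin S False mS finite_subset by auto
    then obtain b where b: "ranked_first (S - {m}) ax b"
      using ranked_first_exists_subset[OF _ _ _ ax] by blast
    have mb: "precedes ax m b" using m b by (auto simp: ranked_first_def precedes_def)
    have "ranked_first S (P i) m" if i: "i \<in> voters n" "precedes (P i) m b" for i
      unfolding ranked_first_def
    proof (intro conjI ballI)
      fix z assume z: "z \<in> S"
      show "(m, z) \<in> P i"
      proof (cases "z = m \<or> z = b")
        case True
        then show ?thesis using i refl by (auto simp: precedes_def)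
      next
        case False
        then have "precedes ax b z" using b z by (auto simp: ranked_first_def precedes_def)
        then have "precedes (P i) b z"
          using single_peaked_wrtD(1)[OF sp mb] i b mS z S by (auto simp: ranked_first_def)
        then show ?thesis
          using i lin[OF i(1)] by (auto simp: precedes_def order_on_defs dest: transD)
      qed
    qed (rule mS)
    then have "card {i \<in> voters n. precedes (P i) m b} \<le> first_count S n P m"
      unfolding first_count_def by (intro card_mono) auto
    moreover have "n < 2 * card {i \<in> voters n. precedes (P i) m b}"
      using beats b by (auto simp: beats_all_def ranked_first_def)
    ultimately show ?thesis by linarith
  qed
  then show ?thesis using mS by (auto simp: has_majority_winner_def)
qed

text \<open>A voter ranking \<open>y\<close> last prefers \<open>x\<close> to \<open>y\<close>, and
  by single-peakedness \<open>y\<close> to \<open>z\<close>, which contradicts \<open>y\<close>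
  being last.\<close>

lemma interior_last_count:
  assumes prof: "is_profile A n P" and sp: "single_peaked_wrt A n ax P" and S: "S \<subseteq> A"
    and y: "precedes ax x y" "precedes ax y z" "x \<in> S" "y \<in> S" "z \<in> S"
  shows "last_count S n P y = 0"
proof -
  have "\<not> ranked_last S (P i) y" if i: "i \<in> voters n" for i
  proof
    assume "ranked_last S (P i) y"
    then have xy: "precedes (P i) x y" and zy: "(z, y) \<in> P i"
      using y by (auto simp: ranked_last_def precedes_def)
    have "precedes (P i) y z"
      using single_peaked_wrtD(1)[OF sp y(1,2) _ _ _ i xy] y S by auto
    with zy prof i show False
      by (auto simp: is_profile_def precedes_def dest: linear_order_on_antisymD)
  qed
  then show ?thesis by (simp add: last_count_def)
qed

section \<open>The effect of a single round\<close>

text \<open>Between two alternatives, ranking one last is preferring the other, so the round is a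
  majority vote, which \<open>m\<close> wins.\<close>

lemma least_unpopular_beats_all:
  assumes prof: "is_profile A n P" and S: "S \<subseteq> A" and m: "m \<in> S" and "card S \<le> 2"
    and fin: "finite S" and beats: "beats_all S n P m"
  shows "least_unpopular S n P = {m}"
proof (cases "S = {m}")
  case True
  then show ?thesis by (auto simp: least_unpopular_def)
next
  case False
  have "card (S - {m}) \<le> 1" "S - {m} \<noteq> {}" "finite (S - {m})" using assms False by auto
  then have "card (S - {m}) = 1" by (metis card_0_eq le_antisym less_one not_le)
  then obtain x where "S - {m} = {x}" by (auto simp: card_1_singleton_iff)
  then have x: "S = {m, x}" "x \<noteq> m" using m by auto
  have lin: "linear_order_on A (P i)" if "i \<in> voters n" for i
    using prof that by (simp add: is_profile_def)
  have refl: "(y, y) \<in> P i" if "i \<in> voters n" "y \<in> S" for i y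
    using linear_order_on_cases[OF lin[OF that(1)], of y y] that S by (auto simp: precedes_def)
  let ?M = "{i \<in> voters n. precedes (P i) m x}"
  have "{i \<in> voters n. ranked_last S (P i) x} = ?M"
    using refl x by (auto simp: ranked_last_def precedes_def)
  then have cx: "last_count S n P x = card ?M" by (simp add: last_count_def)
  have "{i \<in> voters n. ranked_last S (P i) m} = voters n - ?M"
    using refl x linear_order_on_not_precedes[OF lin, of _ x m] S
    by (auto simp: ranked_last_def)
  moreover have "card (voters n - ?M) = n - card ?M"
    by (subst card_Diff_subset) auto
  ultimately have "last_count S n P m = n - card ?M" by (simp add: last_count_def)
  moreover have "n < 2 * card ?M" using beats x by (auto simp: beats_all_def)
  ultimately have "last_count S n P m < last_count S n P x" using cx by linarith
  then show ?thesis by (auto simp: least_unpopular_def x(1))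
qed

text \<open>One round reaches \<open>{m}\<close>, and a singleton is a fixed point of all further
  rounds.\<close>

lemma LUR_stage_beats_all:
  assumes "is_profile A n P" "S \<subseteq> A" "m \<in> S" "card S \<le> 2" "finite S" "beats_all S n P m"
  shows "LUR_stage S n P (Suc k) = {m}"
proof (induction k)
  case 0
  then show ?case using least_unpopular_beats_all[OF assms] by simp
next
  case (Suc k)
  have "least_unpopular {m} n P = {m}" by (auto simp: least_unpopular_def)
  with Suc show ?case by simp
qed

text \<open>All \<open>n\<close> last places belong to \<open>z\<close>, so the others have none and
  survive. Whoever is first without \<open>z\<close> is also first with it, so deleting
  \<open>z\<close> creates no majority winner.\<close>

lemma remove_unanimous_last:
  assumes prof: "is_profile A n P" and n: "n > 0" and S: "S \<subseteq> A"
    and m: "m \<in> S" "last_count S n P m = 0"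
    and z: "\<And>i. i \<in> voters n \<Longrightarrow> ranked_last S (P i) z"
  shows "least_unpopular S n P = S - {z}"
    and "has_majority_winner (S - {z}) n P \<Longrightarrow> has_majority_winner S n P"
proof -
  have "{i \<in> voters n. ranked_last S (P i) z} = voters n" using z by blast
  then have cz: "last_count S n P z = n" unfolding last_count_def by simp
  have "\<not> ranked_last S (P i) x" if "i \<in> voters n" "x \<noteq> z" for i x
    using ranked_last_unique z that prof by (metis is_profile_def)
  then have "last_count S n P x = 0" if "x \<noteq> z" for x
    using that by (simp add: last_count_def)
  with cz m n show "least_unpopular S n P = S - {z}"
    by (auto simp: least_unpopular_def)
next
  have "ranked_first S (P i) x" if "i \<in> voters n" "ranked_first (S - {z}) (P i) x" for i x
    using that z[OF that(1)] by (auto simp: ranked_first_def ranked_last_def)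
  then have "first_count (S - {z}) n P x \<le> first_count S n P x" for x
    unfolding first_count_def by (intro card_mono) auto
  then show "has_majority_winner (S - {z}) n P \<Longrightarrow> has_majority_winner S n P"
    unfolding has_majority_winner_def by (meson DiffD1 less_le_trans mult_le_mono2)
qed

section \<open>Induction over the rounds\<close>

text \<open>The set \<open>S\<close> of survivors varies while the axis and the ballots stay those
  of \<open>A\<close>. The bound \<open>card S \<le> k\<close> guarantees enough rounds; the bound 4
  leaves at most two alternatives once both ends are removed.\<close>

lemma LUR_stage_no_majority:
  assumes fin: "finite A" and prof: "is_profile A n P" and n: "n > 0"
    and sp: "single_peaked_wrt A n ax P"
    and "S \<subseteq> A" "m \<in> S" "beats_all S n P m" "\<not> has_majority_winner S n P"
    and "card S \<le> 4" "card S \<le> k"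
  shows "LUR_stage S n P k = {m}"
  using assms(5-)
proof (induction k arbitrary: S)
  case 0
  then show ?case using fin finite_subset[of S A] by auto
next
  case (Suc k)
  note S = \<open>S \<subseteq> A\<close> and m = \<open>m \<in> S\<close>
  have finS: "finite S" using S fin finite_subset by blast
  have ax: "linear_order_on A ax" using sp by (simp add: single_peaked_wrt_def)
  obtain lo hi where lo: "ranked_first S ax lo" and hi: "ranked_last S ax hi"
    using ranked_first_exists_subset[OF finS _ S ax] ranked_last_exists_subset[OF finS _ S ax] m
    by blast
  have m_lo: "m \<noteq> lo"
    using axis_end_majority[OF fin prof n sp S] lo Suc.prems by blast
  \<comment> \<open>The right end is the left end of the reversed axis.\<close>
  have m_hi: "m \<noteq> hi"
    using axis_end_majority[OF fin prof n single_peaked_wrt_converse[OF sp] S] hi Suc.prems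
    by auto
  have inS: "lo \<in> S" "hi \<in> S" using lo hi by (auto simp: ranked_first_def ranked_last_def)
  have "lo \<noteq> hi"
    using lo hi m m_lo linear_order_on_antisymD[OF ax]
    by (auto simp: ranked_first_def ranked_last_def)
  have interior: "last_count S n P x = 0" if "x \<in> S" "x \<noteq> lo" "x \<noteq> hi" for x
    by (rule interior_last_count[OF prof sp S, of lo x hi])
      (use that lo hi in \<open>auto simp: ranked_first_def ranked_last_def precedes_def\<close>)
  show ?case
  proof (cases "\<exists>z. \<forall>i\<in>voters n. ranked_last S (P i) z")
    case True
    then obtain z where z: "\<And>i. i \<in> voters n \<Longrightarrow> ranked_last S (P i) z" by blast
    note rem = remove_unanimous_last[OF prof n S m interior[OF m m_lo m_hi] z]
    have "z \<in> S" using z[of 1] n by (simp add: ranked_last_def)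
    \<comment> \<open>Having no last place is minimal, so \<open>m\<close> survives; by
      \<open>rem\<close> this gives \<open>m \<noteq> z\<close>.\<close>
    have "m \<in> least_unpopular S n P"
      using m interior[OF m m_lo m_hi] by (simp add: least_unpopular_def)
    with rem have "m \<in> S - {z}" by simp
    have "LUR_stage (S - {z}) n P k = {m}"
    proof (rule Suc.IH)
      show "beats_all (S - {z}) n P m" using Suc.prems(3) by (rule beats_all_mono) auto
    qed (use Suc.prems rem \<open>m \<in> S - {z}\<close> \<open>z \<in> S\<close> finS in auto)
    with rem show ?thesis by (simp only: LUR_stage_Suc_first)
  next
    case False
    \<comment> \<open>Here \<open>x\<close> and \<open>y\<close> are the two ends in either order.
      If \<open>x\<close> had no last place, every voter would have to rank \<open>y\<close> last,
      the case excluded by \<open>False\<close>.\<close>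
    have pos: "last_count S n P x > 0" if x: "{x, y} = {lo, hi}" for x y
    proof (rule ccontr)
      assume "\<not> 0 < last_count S n P x"
      then have zero: "last_count S n P u = 0" if "u \<in> S" "u \<noteq> y" for u
        using interior x that by (cases "u = x") (auto simp: doubleton_eq_iff)
      have "ranked_last S (P i) y" if i: "i \<in> voters n" for i
      proof -
        obtain u where u: "ranked_last S (P i) u"
          using ranked_last_exists_subset[OF finS _ S, of "P i"] m prof i
          unfolding is_profile_def by blast
        then have "last_count S n P u > 0" "u \<in> S"
          using i by (auto simp: last_count_def card_gt_0_iff ranked_last_def)
        with zero u show ?thesis by (metis less_irrefl)
      qed
      with False show False by blast
    qed
    have "last_count S n P lo > 0" "last_count S n P hi > 0"
      using pos[of lo hi] pos[of hi lo] by (simp_all add: insert_commute)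
    \<comment> \<open>The minimal count is 0, attained by \<open>m\<close>, and exactly the two ends
      exceed it.\<close>
    then have T: "least_unpopular S n P = S - {lo, hi}"
      using interior m m_lo m_hi by (fastforce simp: least_unpopular_def)
    \<comment> \<open>Three distinct members force \<open>k \<ge> 2\<close>, so a round remains for
      the majority vote.\<close>
    have "card {m, lo, hi} \<le> card S" using m inS finS by (intro card_mono) auto
    then have "card S \<ge> 3" using m_lo m_hi \<open>lo \<noteq> hi\<close> by simp
    then obtain j where j: "k = Suc j" using Suc.prems by (cases k) auto
    have "LUR_stage (S - {lo, hi}) n P (Suc j) = {m}"
    proof (rule LUR_stage_beats_all[OF prof])
      show "beats_all (S - {lo, hi}) n P m" using Suc.prems(3) by (rule beats_all_mono) auto
      have "card (S - {lo, hi}) = card S - 2"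
        using inS \<open>lo \<noteq> hi\<close> by (simp add: card_Diff_subset)
      then show "card (S - {lo, hi}) \<le> 2" using Suc.prems by simp
    qed (use S m m_lo m_hi finS in auto)
    then show ?thesis by (simp only: LUR_stage_Suc_first T j)
  qed
qed

section \<open>The counterexample for first-past-the-post\<close>

text \<open>The ballots and the axis of the example are given by numeric keys; the smaller key is
  ranked higher, or lies further left.\<close>

lemma linear_order_on_key:
  fixes f :: "'a \<Rightarrow> nat"
  assumes "inj_on f A"
  shows "linear_order_on A {(x, y). x \<in> A \<and> y \<in> A \<and> f x \<le> f y}"
  using assms
  by (auto simp: order_on_defs refl_on_def total_on_def trans_def antisym_def inj_on_def)

text \<open>
  The axis is \<open>0 < 1 < 2\<close>, with two voters at either end and one in the middle: the median
  top \<open>1\<close> has a single first place.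
\<close>

lemma median_not_FPTP:
  "\<exists>(A :: nat set) (n :: nat) (P :: nat profile) ax v.
     finite A \<and> A \<noteq> {} \<and> card A \<le> 4 \<and> odd n \<and> is_profile A n P \<and>
     single_peaked_wrt A n ax P \<and> \<not> has_majority_winner A n P \<and>
     is_median_voter A n ax P v \<and> top_choice A (P v) \<notin> FPTP A n P"
proof -
  define A :: "nat set" where "A = {0, 1, 2}"
  define top :: "nat \<Rightarrow> nat" where "top i = (if i \<le> 2 then 0 else if i = 3 then 1 else 2)" for i
  \<comment> \<open>\<open>key t\<close> encodes the ballot with top \<open>t\<close>: from best to
    worst \<open>0, 1, 2\<close> for \<open>t = 0\<close>, then \<open>1, 0, 2\<close>, then
    \<open>2, 1, 0\<close>.\<close>
  define key :: "nat \<Rightarrow> nat \<Rightarrow> nat" where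
    "key t x = (if t = 0 then x else if t = 1 then [1, 0, 2] ! x else 2 - x)" for t x
  define P :: "nat profile" where
    "P i = {(x, y). x \<in> A \<and> y \<in> A \<and> key (top i) x \<le> key (top i) y}" for i
  define ax :: "nat rel" where "ax = {(x, y). x \<in> A \<and> y \<in> A \<and> x \<le> y}"
  have voters: "voters 5 = {1, 2, 3, 4, 5}" by auto
  have prof: "is_profile A 5 P"
    unfolding is_profile_def P_def
    by (intro ballI linear_order_on_key) (auto simp: A_def key_def inj_on_def)
  have ax: "linear_order_on A ax"
    unfolding ax_def by (rule linear_order_on_key) (rule inj_on_id2)
  have sp: "single_peaked_wrt A 5 ax P"
    using ax
    by (auto simp: single_peaked_wrt_def voters precedes_def P_def ax_def A_def key_def top_def)
  have first: "ranked_first A (P i) x \<longleftrightarrow> x = top i" for i x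
    by (auto simp: ranked_first_def P_def A_def key_def top_def)
  have top: "top_choice A (P i) = top i" for i
    by (simp add: top_choice_def first)
  have "{i \<in> voters 5. ranked_first A (P i) 0} = {1, 2}"
    "{i \<in> voters 5. ranked_first A (P i) 1} = {3}"
    "{i \<in> voters 5. ranked_first A (P i) 2} = {4, 5}"
    by (auto simp: first top_def split: if_splits)
  then have count: "first_count A 5 P 0 = 2" "first_count A 5 P 1 = 1" "first_count A 5 P 2 = 2"
    unfolding first_count_def by simp_all
  have "(top j, top k) \<in> ax" if "j \<le> k" for j k
    using that by (auto simp: ax_def A_def top_def)
  \<comment> \<open>The voters are numbered in the axis order of their tops, so the identity sorts
    them and position \<open>(5 + 1) div 2 = 3\<close> is voter 3.\<close>
  then have "sorts_voters A 5 ax P id"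
    by (simp add: sorts_voters_def top)
  then have "is_median_voter A 5 ax P 3"
    unfolding is_median_voter_def by (intro exI[of _ id]) simp
  moreover have "\<not> has_majority_winner A 5 P"
    using count by (auto simp: has_majority_winner_def A_def)
  moreover have "top_choice A (P 3) \<notin> FPTP A 5 P"
    using count unfolding top by (auto simp: FPTP_def top_def A_def)
  moreover have "finite A" "A \<noteq> {}" "card A \<le> 4" by (simp_all add: A_def)
  moreover have "odd (5 :: nat)" by simp
  ultimately show ?thesis using prof sp by blast
qed

theorem proposition6:
  shows
    "(\<forall>(A :: 'a set) (n :: nat) (P :: 'a profile).
        finite A \<and> A \<noteq> {} \<and> card A \<le> 4 \<and> odd n \<and> is_profile A n P \<and>
        single_peaked A n P \<and> \<not> has_majority_winner A n P \<longrightarrow>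
        (\<forall>ax v. single_peaked_wrt A n ax P \<and> is_median_voter A n ax P v \<longrightarrow>
           LUR A n P = {top_choice A (P v)})) \<and>
     (\<exists>(A :: nat set) (n :: nat) (P :: nat profile) ax v.
        finite A \<and> A \<noteq> {} \<and> card A \<le> 4 \<and> odd n \<and> is_profile A n P \<and>
        single_peaked_wrt A n ax P \<and> \<not> has_majority_winner A n P \<and>
        is_median_voter A n ax P v \<and> top_choice A (P v) \<notin> FPTP A n P)"
proof (intro conjI allI impI; (elim conjE)?)
  fix A :: "'a set" and n :: nat and P :: "'a profile" and ax v
  assume fin: "finite A" and ne: "A \<noteq> {}" and card: "card A \<le> 4" and n: "odd n"
    and prof: "is_profile A n P" and no_majority: "\<not> has_majority_winner A n P"
    and sp: "single_peaked_wrt A n ax P" and med: "is_median_voter A n ax P v"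
  note m = median_beats_all[OF fin ne prof n sp med]
  show "LUR A n P = {top_choice A (P v)}"
    unfolding LUR_def
    by (rule LUR_stage_no_majority[OF fin prof odd_pos[OF n] sp subset_refl
          conjunct1[OF m] conjunct2[OF m] no_majority card order_refl])
qed (rule median_not_FPTP)

end
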